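(* Let $\mathcal T\subset\mathbb R^N$ be a given polyhedron of dimension $N$. Let $\theta=(\theta_1,\theta_2)\in\mathbb R_+^N\times\mathbb R^N$, where $\mathbb R_+=(0,\infty)$ is the positive real line, and let $$\mathcal P(\theta)=\operatorname{diag}(\theta_1)\,\mathcal T+\theta_2=\{\operatorname{diag}(\theta_1)\mathbf r+\theta_2\mid\mathbf r\in\mathcal T\},$$ where $\operatorname{diag}(\theta_1)$ denotes the diagonal matrix with diagonal $\theta_1$. Then, for the given initial state $x_0\in\mathbb R^{n_x}$, the set $$\Theta(x_0)=\{\theta\in\mathbb R_+^N\times\mathbb R^N\mid\mathcal F_\theta(x_0)\neq\emptyset\}$$ is convex.
   Context: System and constraints: consider the discrete-time linear system $x_{i+1}=Ax_i+Bu_i$ with $x_i\in\mathbb R^{n_x}$, $u_i\in\mathbb R^{n_u}$, polytopic state-input constraints $Fx_i+Gu_i\le c$, and a polytopic terminal constraint $x_N\in\mathbb X_f=\{x\mid Hx\le p\}$, over a fixed horizon $N$. Write $\mathbf u=(u_0^T,\dots,u_{N-1}^T)^T$ and $\mathbf x=(x_0^T,\dots,x_N^T)^T$. In condensed form the dynamics and constraints are $\mathbf x=\mathbf A x_0+\mathbf B\mathbf u$ and $\mathbf F\mathbf x+\mathbf G\mathbf u\le\mathbf c$, where $\mathbf A,\mathbf B$ stack the dynamics and $\mathbf F,\mathbf G,\mathbf c$ stack the stage constraints for $i=0,\dots,N-1$ and the terminal constraint. Set $\Sigma:=\mathbf F\mathbf B+\mathbf G$, $\sigma:=\mathbf c$,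 $\Xi:=-\mathbf F\mathbf A$. Tracking: the reference $\mathbf r=(r_0,\dots,r_{N-1})\in\mathbb R^N$ must be tracked through $g^Tu_i=r_i$ for a given vector $g\in\mathbb R^{n_u}$. Set $\Gamma:=\mathcal I_N\otimes g^T\in\mathbb R^{N\times Nn_u}$, where $\mathcal I_N$ is the $N\times N$ identity and $\otimes$ the Kronecker product. Policies: affine policies are $\mathbf u=\mathbf M\mathbf r+\mathbf v$ with $\mathbf M\in\mathbb R^{Nn_u\times N}$, $\mathbf v\in\mathbb R^{Nn_u}$. The notation $\mathbf M\in\mathcal{LT}$ means that $\mathbf M$ is block lower triangular, with blocks $M_{i,j}\in\mathbb R^{n_u\times 1}$, $i,j\in\{0,\dots,N-1\}$, and $M_{i,j}=0$ for $j>i$. For a parameter $\theta$ with associated reference set $\mathcal P(\theta)\subset\mathbb R^N$ and an initial state $x_0$, the set of admissible affine policies is $$\mathcal F_\theta(x_0)=\{(\mathbf M,\mathbf v)\mid \mathbf M\in\mathcal{LT},\ \text{and}\ \forall\mathbf r\in\mathcal P(\theta):\ \Sigma(\mathbf M\mathbf r+\mathbf v)\le\sigma+\Xi x_0,\ \Gamma(\mathbf M\mathbf r+\mathbf v)=\mathbf r\}.$$ All vector inequalities are componentwise. *)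

theory Defs
  imports "HOL-Analysis.Analysis"
begin

text \<open>
  Stages \<open>0, \<dots>, N - 1\<close> are the elements of a finite linearly ordered type \<open>'h\<close> with
  \<open>N = CARD('h)\<close>; times \<open>0, \<dots>, N\<close> are the elements of \<open>'h + unit\<close>, where \<open>Inr ()\<close>
  is the terminal time. Stacked vectors are indexed by pairs (block, component), and the rows of the
  stacked constraints by \<open>('h \<times> 'c) + 'p\<close>: the stage constraints, then the terminal ones.
\<close>

definition stage :: "'h::{finite,linorder} \<Rightarrow> nat" where
  "stage i = card {..<i}"

definition time_of :: "'h::{finite,linorder} + unit \<Rightarrow> nat" where
  "time_of t = (case t of Inl i \<Rightarrow> stage i | Inr _ \<Rightarrow> CARD('h))"

definition block :: "real ^ ('t \<times> 'k) \<Rightarrow> 't::finite \<Rightarrow> real ^ 'k::finite" where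
  "block y t = (\<chi> k. y $ (t, k))"

text \<open>The power operation \<open>^\<close> on \<open>real ^ 'n ^ 'n\<close> is componentwise, hence:\<close>

definition mat_pow :: "real ^ 'n ^ 'n \<Rightarrow> nat \<Rightarrow> real ^ 'n ^ 'n" where
  "mat_pow A k = (((**) A) ^^ k) (mat 1)"

definition kron :: "real ^ 'b ^ 'a \<Rightarrow> real ^ 'd ^ 'c \<Rightarrow> real ^ ('b \<times> 'd) ^ ('a \<times> 'c)" where
  "kron X Y = (\<chi> r s. X $ fst r $ fst s * Y $ snd r $ snd s)"

definition diag :: "real ^ 'n \<Rightarrow> real ^ 'n ^ 'n" where
  "diag d = (\<chi> i j. if i = j then d $ i else 0)"

definition stacked_A ::
  "real ^ 'x ^ 'x \<Rightarrow> real ^ 'x ^ (('h::{finite,linorder} + unit) \<times> 'x::finite)" where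
  "stacked_A A = (\<chi> r. mat_pow A (time_of (fst r)) $ snd r)"

definition stacked_B ::
  "real ^ 'x ^ 'x \<Rightarrow> real ^ 'u ^ 'x \<Rightarrow>
   real ^ ('h \<times> 'u::finite) ^ (('h::{finite,linorder} + unit) \<times> 'x::finite)" where
  "stacked_B A B = (\<chi> r s.
     if stage (fst s) < time_of (fst r)
     then (mat_pow A (time_of (fst r) - Suc (stage (fst s))) ** B) $ snd r $ snd s
     else 0)"

definition stacked_F ::
  "real ^ 'x ^ 'c \<Rightarrow> real ^ 'x ^ 'p \<Rightarrow>
   real ^ (('h::{finite,linorder} + unit) \<times> 'x::finite) ^ (('h \<times> 'c::finite) + 'p::finite)" where
  "stacked_F F H = (\<chi> r s. case r of
     Inl (i, m) \<Rightarrow> if fst s = Inl i then F $ m $ snd s else 0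
   | Inr m \<Rightarrow> if fst s = Inr () then H $ m $ snd s else 0)"

definition stacked_G ::
  "real ^ 'u ^ 'c \<Rightarrow>
   real ^ ('h::{finite,linorder} \<times> 'u::finite) ^ (('h \<times> 'c::finite) + 'p::finite)" where
  "stacked_G G = (\<chi> r s. case r of
     Inl (i, m) \<Rightarrow> if fst s = i then G $ m $ snd s else 0
   | Inr m \<Rightarrow> 0)"

definition stacked_c ::
  "real ^ 'c \<Rightarrow> real ^ 'p \<Rightarrow> real ^ (('h::{finite,linorder} \<times> 'c::finite) + 'p::finite)" where
  "stacked_c c p = (\<chi> r. case r of Inl (i, m) \<Rightarrow> c $ m | Inr m \<Rightarrow> p $ m)"

definition Sigma_mat ::
  "real ^ 'x ^ 'x \<Rightarrow> real ^ 'u ^ 'x \<Rightarrow> real ^ 'x ^ 'c \<Rightarrow> real ^ 'u ^ 'c \<Rightarrow> real ^ 'x ^ 'p \<Rightarrow>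
   real ^ ('h::{finite,linorder} \<times> 'u::finite) ^ (('h \<times> 'c::finite) + 'p::finite)" where
  "Sigma_mat A B F G H = stacked_F F H ** stacked_B A B + stacked_G G"

definition sigma_vec ::
  "real ^ 'c \<Rightarrow> real ^ 'p \<Rightarrow> real ^ (('h::{finite,linorder} \<times> 'c::finite) + 'p::finite)" where
  "sigma_vec c p = stacked_c c p"

definition Xi_mat ::
  "real ^ 'x ^ 'x \<Rightarrow> real ^ 'x ^ 'c \<Rightarrow> real ^ 'x ^ 'p \<Rightarrow>
   real ^ 'x ^ (('h::{finite,linorder} \<times> 'c::finite) + 'p::finite)" where
  "Xi_mat A F H = - (stacked_F F H ** stacked_A A)"

text \<open>\<open>I\<^sub>N \<otimes> g\<^sup>T\<close>; its row index set \<open>'h \<times> 1\<close> is identified with \<open>'h\<close>.\<close>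

definition Gamma_mat :: "real ^ 'u \<Rightarrow> real ^ ('h \<times> 'u::finite) ^ ('h::{finite,linorder})" where
  "Gamma_mat g = (\<chi> i. kron (mat 1) (rowvector g :: real ^ 'u ^ 1) $ (i, 1))"

definition block_lower_triangular ::
  "real ^ ('h::{finite,linorder}) ^ ('h \<times> 'u::finite) \<Rightarrow> bool" where
  "block_lower_triangular M \<longleftrightarrow> (\<forall>i j k. i < j \<longrightarrow> M $ (i, k) $ j = 0)"

definition admissible_policies ::
  "real ^ ('h \<times> 'u) ^ 'q \<Rightarrow> real ^ 'q \<Rightarrow> real ^ 'x ^ 'q \<Rightarrow> real ^ ('h \<times> 'u) ^ ('h::{finite,linorder}) \<Rightarrow>
   (real ^ ('h::{finite,linorder})) set \<Rightarrow> real ^ 'x \<Rightarrow>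
   ((real ^ ('h::{finite,linorder}) ^ ('h \<times> 'u::finite)) \<times> (real ^ ('h \<times> 'u))) set" where
  "admissible_policies \<Sigma> \<sigma> \<Xi> \<Gamma> P x0 =
     {(M, v). block_lower_triangular M \<and>
        (\<forall>r\<in>P. \<Sigma> *v (M *v r + v) \<le> \<sigma> + \<Xi> *v x0 \<and> \<Gamma> *v (M *v r + v) = r)}"

definition reference_set :: "(real ^ 'h) set \<Rightarrow> (real ^ 'h) \<times> (real ^ 'h) \<Rightarrow> (real ^ 'h) set" where
  "reference_set T \<theta> = (\<lambda>r. diag (fst \<theta>) *v r + snd \<theta>) ` T"

definition admissible_parameters ::
  "real ^ 'x ^ 'x \<Rightarrow> real ^ 'u ^ 'x \<Rightarrow> real ^ 'x ^ 'c \<Rightarrow> real ^ 'u ^ 'c \<Rightarrow> real ^ 'c \<Rightarrow>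
   real ^ 'x ^ 'p \<Rightarrow> real ^ 'p \<Rightarrow> real ^ 'u \<Rightarrow> (real ^ ('h::{finite,linorder})) set \<Rightarrow> real ^ 'x \<Rightarrow>
   ((real ^ ('h::{finite,linorder})) \<times> (real ^ ('h::{finite,linorder}))) set" where
  "admissible_parameters A B F G c H p g T x0 =
     {\<theta>. (\<forall>i. 0 < fst \<theta> $ i) \<and>
        admissible_policies (Sigma_mat A B F G H) (sigma_vec c p) (Xi_mat A F H) (Gamma_mat g)
          (reference_set T \<theta>) x0 \<noteq> {}}"

lemma stage_less_card: "stage (i::'h::{finite,linorder}) < CARD('h)"
  unfolding stage_def by (rule psubset_card_mono) auto

lemma stage_less_iff: "stage i < stage j \<longleftrightarrow> i < j"
proof
  show "i < j \<Longrightarrow> stage i < stage j" 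
    unfolding stage_def by (rule psubset_card_mono) auto
  show "stage i < stage j \<Longrightarrow> i < j"
    unfolding stage_def by (meson card_mono finite lessThan_subset_iff not_le)
qed

lemma bij_betw_stage: "bij_betw stage (UNIV :: 'h::{finite,linorder} set) {..<CARD('h)}"
proof -
  have inj: "inj (stage :: 'h \<Rightarrow> nat)"
    by (rule injI) (metis stage_less_iff less_irrefl linorder_neqE)
  have "range (stage :: 'h \<Rightarrow> nat) \<subseteq> {..<CARD('h)}"
    using stage_less_card by auto
  then have "range (stage :: 'h \<Rightarrow> nat) = {..<CARD('h)}"
    by (rule card_subset_eq[rotated]) (auto simp: card_image[OF inj])
  with inj show ?thesis by (simp add: bij_betw_def)
qed

lemma sum_block: 
  fixes f :: "'a::finite \<times> 'b::finite \<Rightarrow> real"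
  shows "(\<Sum>s\<in>UNIV. f s) = (\<Sum>a\<in>UNIV. \<Sum>b\<in>UNIV. f (a, b))"
  by (simp add: sum.cartesian_product)

lemma sum_delta_block:
  fixes f :: "'b::finite \<Rightarrow> real" and a0 :: "'a::finite"
  shows "(\<Sum>a\<in>UNIV. \<Sum>b\<in>UNIV. (if a = a0 then f b else 0) * g a b) = (\<Sum>b\<in>UNIV. f b * g a0 b)"
proof -
  have "(\<Sum>a\<in>UNIV. \<Sum>b\<in>UNIV. (if a = a0 then f b else 0) * g a b) =
    (\<Sum>a\<in>UNIV. if a = a0 then \<Sum>b\<in>UNIV. f b * g a b else 0)"
    by (intro sum.cong) auto
  then show ?thesis by simp
qed

lemma block_stacked_A: "block (stacked_A A *v x0) t = mat_pow A (time_of t) *v x0"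
  by (simp add: vec_eq_iff block_def stacked_A_def matrix_vector_mult_def)

lemma block_stacked_B:
  fixes u :: "real ^ ('h::{finite,linorder} \<times> 'u::finite)"
  shows "block (stacked_B A B *v u) t =
    (\<Sum>j\<in>UNIV. if stage j < time_of t
       then mat_pow A (time_of t - Suc (stage j)) *v (B *v block u j) else 0)"
proof -
  have "(stacked_B A B *v u) $ (t, k) = (\<Sum>j\<in>UNIV. if stage j < time_of t
      then (mat_pow A (time_of t - Suc (stage j)) *v (B *v block u j)) $ k else 0)" for k
    unfolding matrix_vector_mult_def[of "stacked_B A B"] matrix_vector_mul_assoc
    by (simp add: sum_block stacked_B_def, intro sum.cong refl)
      (simp add: matrix_vector_mult_def block_def)
  then show ?thesis
    by (simp add: vec_eq_iff block_def[of "_ *v _"] if_distrib[of "\<lambda>y. y $ _"] cong: if_cong)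
qed

theorem condensed_dynamics:
  fixes u :: "real ^ ('h::{finite,linorder} \<times> 'u::finite)" and X :: "nat \<Rightarrow> real ^ 'x::finite"
  assumes "X 0 = x0" and step: "\<And>i. X (Suc (stage i)) = A *v X (stage i) + B *v block u i"
  shows "block (stacked_A A *v x0 + stacked_B A B *v u) t = X (time_of t)"
proof -
  define S where "S k = (\<Sum>j\<in>(UNIV::'h set). if stage j < k
       then mat_pow A (k - Suc (stage j)) *v (B *v block u j) else 0)" for k
  have S_Suc: "S (Suc k) = A *v S k + B *v block u i" if i: "stage i = k" for k and i :: 'h
  proof -
    have "(if stage j < Suc k then mat_pow A (Suc k - Suc (stage j)) *v (B *v block u j) else 0) =
      A *v (if stage j < k then mat_pow A (k - Suc (stage j)) *v (B *v block u j) else 0)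
      + (if j = i then B *v block u i else 0)" for j
    proof -
      consider "stage j < k" | "j = i" | "stage j > k"
        using i stage_less_iff[of i j] stage_less_iff[of j i] by (metis linorder_neqE)
      then show ?thesis
      proof cases
        case 1
        then have "Suc k - Suc (stage j) = Suc (k - Suc (stage j))" by simp
        with 1 i show ?thesis
          by (auto simp: mat_pow_def matrix_vector_mul_assoc matrix_mul_assoc simp del: diff_Suc_Suc)
      next
        case 2
        with i show ?thesis by (simp add: mat_pow_def)
      next
        case 3
        with i show ?thesis by auto
      qed
    qed
    then show ?thesis
      by (simp add: S_def sum.distrib linear_sum[OF matrix_vector_mul_linear] cong: sum.cong)
  qed
  have "X k = mat_pow A k *v x0 + S k" if "k \<le> CARD('h)" for k
    using that
  proof (induction k)
    case 0
    then show ?case using assms(1) by (simp add: S_def mat_pow_def)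
  next
    case (Suc k)
    then obtain i :: 'h where i: "stage i = k"
      using bij_betw_stage[where 'h='h] unfolding bij_betw_def
      by (metis Suc_le_eq imageE lessThan_iff)
    from Suc have "X k = mat_pow A k *v x0 + S k" by simp
    with step[of i] show ?case unfolding S_Suc[OF i] i
      by (simp add: mat_pow_def matrix_vector_mul_assoc matrix_vector_right_distrib algebra_simps)
  qed
  moreover have "time_of t \<le> CARD('h)"
    using stage_less_card[where 'h='h] by (auto simp: time_of_def less_imp_le split: sum.split)
  ultimately have "X (time_of t) = mat_pow A (time_of t) *v x0 + S (time_of t)" by blast
  moreover have "block (y + z) t = block y t + block z t" for y z :: "real ^ (('h + unit) \<times> 'x)"
    by (simp add: block_def vec_eq_iff)
  ultimately show ?thesis
    by (simp add: block_stacked_A block_stacked_B S_def)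
qed

theorem condensed_constraints:
  fixes u :: "real ^ ('h::{finite,linorder} \<times> 'u::finite)"
    and x :: "real ^ (('h + unit) \<times> 'x::finite)"
  shows "stacked_F F H *v x + stacked_G G *v u \<le> stacked_c c p \<longleftrightarrow>
    (\<forall>i. F *v block x (Inl i) + G *v block u i \<le> c) \<and> H *v block x (Inr ()) \<le> p"
proof -
  have 1: "(stacked_F F H *v x + stacked_G G *v u) $ Inl (i, m) =
      (F *v block x (Inl i) + G *v block u i) $ m" for i m
    using sum_delta_block[of "Inl i :: 'h + unit" "\<lambda>b. F $ m $ b" "\<lambda>a b. x $ (a, b)"]
      sum_delta_block[of i "\<lambda>b. G $ m $ b" "\<lambda>a b. u $ (a, b)"]
    by (simp add: stacked_F_def stacked_G_def matrix_vector_mult_def sum_block block_def cong: if_cong)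
  have 2: "(stacked_F F H *v x + stacked_G G *v u) $ Inr m = (H *v block x (Inr ())) $ m" for m
    using sum_delta_block[of "Inr () :: 'h + unit" "\<lambda>b. H $ m $ b" "\<lambda>a b. x $ (a, b)"]
    by (simp add: stacked_F_def stacked_G_def matrix_vector_mult_def sum_block block_def cong: if_cong)
  have split: "(\<forall>r. P r) \<longleftrightarrow> (\<forall>i m. P (Inl (i, m))) \<and> (\<forall>m. P (Inr m))"
    for P :: "('h \<times> 'c) + 'p \<Rightarrow> bool"
    by (metis surj_pair sumE)
  show ?thesis
    unfolding less_eq_vec_def split 1 2 by (simp add: stacked_c_def)
qed

lemma Gamma_mat_component: "(Gamma_mat g *v u) $ i = g \<bullet> block u i"
proof -
  have "(Gamma_mat g *v u) $ i =
      (\<Sum>a\<in>UNIV. \<Sum>b\<in>UNIV. (if a = i then g $ b else 0) * u $ (a, b))"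
    unfolding Gamma_mat_def matrix_vector_mult_def sum_block
    by (auto simp: kron_def mat_def rowvector_def intro!: sum.cong)
  then show ?thesis by (simp add: sum_delta_block[where g="\<lambda>a b. u $ (a, b)"] inner_vec_def block_def)
qed

end

theory Submission
  imports Defs
begin

text \<open>
  Writing a reference as \<open>diag \<theta>\<^sub>1 *v r + \<theta>\<^sub>2\<close> with \<open>r \<in> T\<close>, the input \<open>M *v (diag \<theta>\<^sub>1 *v r + \<theta>\<^sub>2) + v\<close>
  equals \<open>K *v r + w\<close> with \<open>K = M ** diag \<theta>\<^sub>1\<close> and \<open>w = M *v \<theta>\<^sub>2 + v\<close>. As \<open>\<theta>\<^sub>1\<close> is positive, this
  substitution is invertible, and since \<open>diag \<theta>\<^sub>1\<close> only rescales columns it preserves block lower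
  triangularity. In the variables \<open>(K, w, \<theta>)\<close> all constraints are jointly convex and are indexed
  by \<open>T\<close>, which does not depend on \<open>\<theta>\<close>; the parameter set is a projection of the solution set.
\<close>

lemma matrix_mult_diag_component: "(M ** diag d) $ i $ j = M $ i $ j * d $ j"
  by (simp add: matrix_matrix_mult_def diag_def if_distrib[of "\<lambda>y. _ * y"] cong: if_cong)

text \<open>Linearity of \<open>diag\<close> makes the tracking equation linear in \<open>K\<close>,
  \<open>w\<close> and the parameter jointly.\<close>

lemma diag_add_scaleR: "diag (a *\<^sub>R d + b *\<^sub>R e) = a *\<^sub>R diag d + b *\<^sub>R diag e"
  by (simp add: diag_def vec_eq_iff)

lemma block_lower_triangular_mult_diag:
  "block_lower_triangular M \<Longrightarrow> block_lower_triangular (M ** diag d)"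
  by (simp add: block_lower_triangular_def matrix_mult_diag_component)

lemma block_lower_triangular_add_scaleR:
  "block_lower_triangular M \<Longrightarrow> block_lower_triangular M' \<Longrightarrow>
    block_lower_triangular (a *\<^sub>R M + b *\<^sub>R M')"
  by (simp add: block_lower_triangular_def)

lemma matrix_vector_mult_add_scaleR:
  fixes M :: "real ^ 'n ^ 'm"
  shows "M *v (a *\<^sub>R y + b *\<^sub>R z) = a *\<^sub>R (M *v y) + b *\<^sub>R (M *v z)"
  by (simp add: matrix_vector_right_distrib matrix_vector_mult_scaleR)

lemma add_scaleR_matrix_vector_mult:
  fixes M M' :: "real ^ 'n ^ 'm"
  shows "(a *\<^sub>R M + b *\<^sub>R M') *v y = a *\<^sub>R (M *v y) + b *\<^sub>R (M' *v y)"
  by (simp add: matrix_vector_mult_add_rdistrib scaleR_matrix_vector_assoc)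

text \<open>Positivity enters only from right to left, where \<open>diag (fst \<theta>)\<close> has
  to be inverted; the forward direction is pure substitution.\<close>

lemma admissible_policies_nonempty_iff:
  fixes \<Sigma> :: "real ^ ('h::{finite,linorder} \<times> 'u::finite) ^ 'q"
  assumes pos: "\<And>i. 0 < fst \<theta> $ i"
  shows "admissible_policies \<Sigma> \<sigma> \<Xi> \<Gamma> (reference_set T \<theta>) x0 \<noteq> {} \<longleftrightarrow>
    (\<exists>K w. block_lower_triangular K \<and>
       (\<forall>r\<in>T. \<Sigma> *v (K *v r + w) \<le> \<sigma> + \<Xi> *v x0 \<and>
              \<Gamma> *v (K *v r + w) = diag (fst \<theta>) *v r + snd \<theta>))"
    (is "?L \<longleftrightarrow> ?R")
proof
  have subst: "M *v (diag (fst \<theta>) *v r + snd \<theta>) + v =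
      (M ** diag (fst \<theta>)) *v r + (M *v snd \<theta> + v)" for M and v :: "real ^ ('h::{finite,linorder} \<times> 'u)" and r
    by (simp add: matrix_vector_right_distrib matrix_vector_mul_assoc)
  show ?R if ?L
  proof -
    from that obtain M v where "(M, v) \<in> admissible_policies \<Sigma> \<sigma> \<Xi> \<Gamma> (reference_set T \<theta>) x0"
      by (metis equals0I surj_pair)
    then have "block_lower_triangular M"
      and "\<forall>r\<in>T. \<Sigma> *v ((M ** diag (fst \<theta>)) *v r + (M *v snd \<theta> + v)) \<le> \<sigma> + \<Xi> *v x0 \<and>
        \<Gamma> *v ((M ** diag (fst \<theta>)) *v r + (M *v snd \<theta> + v)) = diag (fst \<theta>) *v r + snd \<theta>"
      by (simp_all add: admissible_policies_def reference_set_def subst)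
    then show ?R
      using block_lower_triangular_mult_diag by blast
  qed
  show ?L if ?R
  proof -
    from that obtain K w where K: "block_lower_triangular K"
      and sol: "\<forall>r\<in>T. \<Sigma> *v (K *v r + w) \<le> \<sigma> + \<Xi> *v x0 \<and>
        \<Gamma> *v (K *v r + w) = diag (fst \<theta>) *v r + snd \<theta>"
      by blast
    \<comment> \<open>Scaling the columns of \<open>K\<close> by reciprocals undoes
      \<open>diag (fst \<theta>)\<close> and keeps the zero pattern.\<close>
    define M where "M = K ** diag (\<chi> i. inverse (fst \<theta> $ i))"
    have "M ** diag (fst \<theta>) = K"
      using pos by (simp add: M_def vec_eq_iff matrix_mult_diag_component less_imp_neq[symmetric])
    \<comment> \<open>The offset solves \<open>w = M *v snd \<theta> + v\<close> for
      \<open>v\<close>.\<close>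
    then have "(M, w - M *v snd \<theta>) \<in> admissible_policies \<Sigma> \<sigma> \<Xi> \<Gamma> (reference_set T \<theta>) x0"
      using sol block_lower_triangular_mult_diag[OF K]
      by (simp add: admissible_policies_def reference_set_def subst) (simp add: M_def)
    then show ?L by blast
  qed
qed

theorem lemma4:
  fixes A :: "real ^ 'x ^ 'x" and B :: "real ^ 'u ^ 'x"
    and F :: "real ^ 'x ^ 'c" and G :: "real ^ 'u ^ 'c" and c :: "real ^ 'c"
    and H :: "real ^ 'x ^ 'p" and p :: "real ^ 'p"
    and g :: "real ^ 'u"
    and T :: "(real ^ 'h::{finite,linorder}) set"
    and x0 :: "real ^ 'x"
  assumes "polyhedron T" and "aff_dim T = int CARD('h)"
  shows "convex (admissible_parameters A B F G c H p g T x0)"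
proof (rule convexI)
  let ?\<Sigma> = "Sigma_mat A B F G H :: real ^ _ ^ (('h::{finite,linorder} \<times> 'c) + 'p)"
  let ?\<Gamma> = "Gamma_mat g :: real ^ _ ^ ('h::{finite,linorder})"
  define s where "s = sigma_vec c p +
    (Xi_mat A F H :: real ^ 'x ^ (('h::{finite,linorder} \<times> 'c) + 'p)) *v x0"
  define sol where "sol \<theta> K w \<longleftrightarrow> block_lower_triangular K \<and>
    (\<forall>r\<in>T. ?\<Sigma> *v (K *v r + w) \<le> s \<and> ?\<Gamma> *v (K *v r + w) = diag (fst \<theta>) *v r + snd \<theta>)"
    for \<theta> K w
  \<comment> \<open>The first conjunct supplies the positivity under which the second may be
    rewritten.\<close>
  have mem_iff: "\<theta> \<in> admissible_parameters A B F G c H p g T x0 \<longleftrightarrow>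
      (\<forall>i. 0 < fst \<theta> $ i) \<and> (\<exists>K w. sol \<theta> K w)" for \<theta>
    unfolding admissible_parameters_def sol_def s_def
    by (simp add: admissible_policies_nonempty_iff cong: conj_cong)
  fix \<theta> \<theta>' and a b :: real
  assume mem: "\<theta> \<in> admissible_parameters A B F G c H p g T x0"
      "\<theta>' \<in> admissible_parameters A B F G c H p g T x0"
    and ab: "0 \<le> a" "0 \<le> b" "a + b = 1"
  from mem obtain K w K' w' where pos: "\<And>i. 0 < fst \<theta> $ i" "\<And>i. 0 < fst \<theta>' $ i"
    and sol: "sol \<theta> K w" "sol \<theta>' K' w'"
    unfolding mem_iff by blast
  \<comment> \<open>If \<open>a = 0\<close>, then \<open>b = 1\<close>; otherwise the first summand
    is already positive.\<close>
  have "0 < a * fst \<theta> $ i + b * fst \<theta>' $ i" for i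
    using pos[of i] ab by (cases "a = 0") (auto intro!: add_pos_nonneg simp: less_imp_le)
  \<comment> \<open>The pairs \<open>(K, w)\<close> are combined rather than the policies
    \<open>(M, v)\<close>, since \<open>M ** diag (fst \<theta>)\<close> is bilinear in the
    unknowns.\<close>
  moreover have "sol (a *\<^sub>R \<theta> + b *\<^sub>R \<theta>') (a *\<^sub>R K + b *\<^sub>R K') (a *\<^sub>R w + b *\<^sub>R w')"
    unfolding sol_def
  proof (intro conjI ballI)
    show "block_lower_triangular (a *\<^sub>R K + b *\<^sub>R K')"
      using sol by (simp add: sol_def block_lower_triangular_add_scaleR)
    fix r assume r: "r \<in> T"
    have input: "(a *\<^sub>R K + b *\<^sub>R K') *v r + (a *\<^sub>R w + b *\<^sub>R w') =
        a *\<^sub>R (K *v r + w) + b *\<^sub>R (K' *v r + w')"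
      by (simp add: add_scaleR_matrix_vector_mult scaleR_right_distrib)
    \<comment> \<open>Both inputs obey the same bound \<open>s\<close>, free of the parameter, so
      \<open>a + b = 1\<close> reproduces it in each component.\<close>
    have "a *\<^sub>R (?\<Sigma> *v (K *v r + w)) + b *\<^sub>R (?\<Sigma> *v (K' *v r + w')) \<le> s"
      using sol r ab unfolding sol_def less_eq_vec_def
      by (auto intro!: convex_bound_le)
    then show "?\<Sigma> *v ((a *\<^sub>R K + b *\<^sub>R K') *v r + (a *\<^sub>R w + b *\<^sub>R w')) \<le> s"
      by (simp only: input matrix_vector_mult_add_scaleR)
    have "?\<Gamma> *v (K *v r + w) = diag (fst \<theta>) *v r + snd \<theta>"
      "?\<Gamma> *v (K' *v r + w') = diag (fst \<theta>') *v r + snd \<theta>'"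
      using sol r by (simp_all add: sol_def)
    then show "?\<Gamma> *v ((a *\<^sub>R K + b *\<^sub>R K') *v r + (a *\<^sub>R w + b *\<^sub>R w')) =
        diag (fst (a *\<^sub>R \<theta> + b *\<^sub>R \<theta>')) *v r + snd (a *\<^sub>R \<theta> + b *\<^sub>R \<theta>')"
      unfolding input matrix_vector_mult_add_scaleR
      by (simp add: diag_add_scaleR add_scaleR_matrix_vector_mult scaleR_right_distrib)
  qed
  ultimately show "a *\<^sub>R \<theta> + b *\<^sub>R \<theta>' \<in> admissible_parameters A B F G c H p g T x0"
    unfolding mem_iff by auto
qed

end
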